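(* Let $\mathcal{Q}\colon\mathbb{R}^q\times\mathbb{R}^q\to\mathbb{R}$, $\Theta\subset\mathbb{R}^q$, the point-to-set map $\mathcal{M}$, the sequence $(\theta_n)_{n\in\mathbb{N}}$ in $\Theta$ with $\theta_{n+1}\in\mathcal{M}(\theta_n)$, and the point $\theta_\star\in\Theta$ be as in the context. Assume: (1) $\Theta$ is convex; (2) $(\theta_n)_{n\in\mathbb{N}}$ converges to $\theta_\star$; (3) there exists a neighborhood of $(\theta_\star,\theta_\star)$ on which $\mathcal{Q}$ is continuous and $\partial_2\mathcal{Q}$ is well-defined and $C^1$-differentiable; (4) the matrix $\mathcal{B}_\star$ is symmetric and for all $v\in\mathsf{V}\setminus\{0\}$, $v^\top\mathcal{A}_\star v>|v^\top\mathcal{B}_\star v|$. Then $\hat\rho_\star\in[0,1)$ and for all $\rho\in(\hat\rho_\star,1)$, $$\theta_n-\theta_\star=o(\rho^n)\quad (n\to\infty),$$ or equivalently, $$\limsup_{n\to\infty}\frac1n\log\|\theta_n-\theta_\star\|_2\le\log\hat\rho_\star .$$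
   Context: Let $q\ge 1$, $\mathcal{Q}\colon\mathbb{R}^q\times\mathbb{R}^q\to\mathbb{R}$, $(\theta,\theta')\mapsto\mathcal{Q}_\theta(\theta')$, and $\Theta\subset\mathbb{R}^q$. For $\theta\in\Theta$ let $\mathcal{M}(\theta):=\operatorname{argmin}_{\theta'\in\Theta}\mathcal{Q}_\theta(\theta')$ (a subset of $\Theta$), assumed nonempty for every $\theta\in\Theta$. $(\theta_n)_{n\in\mathbb{N}}$ is a sequence in $\Theta$ with $\theta_{n+1}\in\mathcal{M}(\theta_n)$ for all $n$. $\partial_2\mathcal{Q}$ is the gradient with respect to the second argument $\theta'$; $\partial_{22}\mathcal{Q}$ and $\partial_{12}\mathcal{Q}$ are the $q\times q$ matrices of derivatives of $\partial_2\mathcal{Q}$ with respect to the second and the first argument respectively. The point $\theta_\star\in\Theta$ is such that $\partial_2\mathcal{Q}$ is well-defined in a neighborhood of $(\theta_\star,\theta_\star)$ and differentiable at $(\theta_\star,\theta_\star)$. $\mathcal{A}_\star:=\partial_{22}\mathcal{Q}_{\theta_\star}(\theta_\star)$, $\mathcal{B}_\star:=-\partial_{12}\mathcal{Q}_{\theta_\star}(\theta_\star)$. $\mathsf{V}:=\mathrm{span}\{\theta-\theta':\theta,\theta'\in\Theta\}$ is the direction of the affine hull of $\Theta$. $$\hat\rho_\star:=\sup_{v\in\mathsf{V}\setminus\{0\}}\frac{|v^\top\mathcal{B}_\star v|}{v^\top\mathcal{A}_\star v}.$$ Convention: $\log 0=-\infty$. $\|\cdot\|_2$ is the Euclidean norm.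 *)

theory Defs
  imports "HOL-Analysis.Analysis" "HOL-Library.Landau_Symbols"
begin

definition argmin_on :: "('a \<Rightarrow> real) \<Rightarrow> 'a set \<Rightarrow> 'a set" where
  "argmin_on f S = {y. is_arg_min f (\<lambda>y. y \<in> S) y}"

definition has_grad2_at ::
    "(real^'q \<Rightarrow> real^'q \<Rightarrow> real) \<Rightarrow> real^'q \<Rightarrow> real^'q \<Rightarrow> bool" where
  "has_grad2_at Q x y \<longleftrightarrow> (\<exists>D. GDERIV (Q x) y :> D)"

text \<open>The gradient with respect to the second argument; meaningful where
  \<open>has_grad2_at\<close> holds (gradients are unique).\<close>

definition grad2 ::
    "(real^'q \<Rightarrow> real^'q \<Rightarrow> real) \<Rightarrow> real^'q \<Rightarrow> real^'q \<Rightarrow> real^'q" where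
  "grad2 Q x y = (THE D. GDERIV (Q x) y :> D)"

definition C1_on :: "('a::real_normed_vector \<Rightarrow> 'b::real_normed_vector) \<Rightarrow> 'a set \<Rightarrow> bool" where
  "C1_on f U \<longleftrightarrow>
     (\<exists>f'. (\<forall>z\<in>U. (f has_derivative blinfun_apply (f' z)) (at z)) \<and> continuous_on U f')"

definition A_mat ::
    "(real^'q \<Rightarrow> real^'q \<Rightarrow> real) \<Rightarrow> real^'q \<Rightarrow> real^'q^'q" where
  "A_mat Q t = jacobian (\<lambda>y. grad2 Q t y) (at t)"

definition B_mat ::
    "(real^'q \<Rightarrow> real^'q \<Rightarrow> real) \<Rightarrow> real^'q \<Rightarrow> real^'q^'q" where
  "B_mat Q t = - jacobian (\<lambda>x. grad2 Q x t) (at t)"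

definition dir_space :: "(real^'q) set \<Rightarrow> (real^'q) set" where
  "dir_space S = span {x - y | x y. x \<in> S \<and> y \<in> S}"

text \<open>The quotients are nonnegative where \<open>A_mat Q t\<close> is positive definite on the
  direction space, and the supremum is taken in \<open>[0, \<infinity>]\<close>. Hence it is \<open>0\<close> when the direction
  space is trivial, whereas the supremum of the empty set in type \<open>ereal\<close> is \<open>- \<infinity>\<close>.\<close>

definition rho_hat ::
    "(real^'q \<Rightarrow> real^'q \<Rightarrow> real) \<Rightarrow> (real^'q) set \<Rightarrow> real^'q \<Rightarrow> ereal" where
  "rho_hat Q S t =
     (if dir_space S = {0} then 0
      else (SUP v \<in> dir_space S - {0}.
              ereal (\<bar>v \<bullet> (B_mat Q t *v v)\<bar> / (v \<bullet> (A_mat Q t *v v)))))"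

text \<open>The logarithm with \<open>log 0 = - \<infinity>\<close> (\<open>ln 0 = 0\<close> on the reals).\<close>

definition elog :: "ereal \<Rightarrow> ereal" where
  "elog x = (if x \<le> 0 then - \<infinity> else if x = \<infinity> then \<infinity> else ereal (ln (real_of_ereal x)))"

end

theory Submission
  imports Defs
begin

text \<open>First-order optimality of \<open>\<theta>\<^sub>n\<^sub>+\<^sub>1\<close> on the convex set, and its limit at the fixed point, tested
  against each other give \<open>(\<partial>\<^sub>2Q(\<theta>\<^sub>n, \<theta>\<^sub>n\<^sub>+\<^sub>1) - \<partial>\<^sub>2Q(\<theta>\<^sub>*, \<theta>\<^sub>*)) \<bullet> e\<^sub>n\<^sub>+\<^sub>1 \<le> 0\<close> for the
  errors \<open>e\<^sub>n = \<theta>\<^sub>n - \<theta>\<^sub>*\<close>. Differentiating \<open>\<partial>\<^sub>2Q\<close> at the fixed point turns this into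
  \<open>e\<^sub>n\<^sub>+\<^sub>1 \<bullet> A e\<^sub>n\<^sub>+\<^sub>1 \<le> e\<^sub>n\<^sub>+\<^sub>1 \<bullet> B e\<^sub>n + o((|e\<^sub>n| + |e\<^sub>n\<^sub>+\<^sub>1|) |e\<^sub>n\<^sub>+\<^sub>1|)\<close>. As \<open>B\<close> is symmetric, polarization
  bounds \<open>e\<^sub>n\<^sub>+\<^sub>1 \<bullet> B e\<^sub>n\<close> by the rate times the product of the \<open>A\<close>-norms, so the \<open>A\<close>-norm of the
  error contracts asymptotically by any factor above the rate.\<close>

subsection \<open>Quadratic forms on a subspace\<close>

lemma continuous_on_quadratic_form:
  fixes M :: "real^'n^'n"
  shows "continuous_on S (\<lambda>v. v \<bullet> (M *v v))"
  by (intro continuous_intros)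

lemma compact_subspace_sphere:
  fixes V :: "'a::euclidean_space set"
  assumes "subspace V"
  shows "compact (V \<inter> sphere 0 1)"
  using assms by (simp add: closed_Int_compact closed_subspace)

lemma subspace_normalize:
  fixes V :: "'a::euclidean_space set"
  assumes "subspace V" "v \<in> V - {0}"
  shows "v /\<^sub>R norm v \<in> V \<inter> sphere 0 1"
  using assms by (auto simp: subspace_scale)

lemma quadratic_form_scaleR:
  fixes M :: "real^'n^'n"
  shows "(c *\<^sub>R v) \<bullet> (M *v (c *\<^sub>R v)) = c\<^sup>2 * (v \<bullet> (M *v v))"
  by (simp add: matrix_vector_mult_scaleR power2_eq_square)

text \<open>The constant is the minimum of the form on the unit sphere of \<open>V\<close>, positive
  by compactness; scaling by the squared norm extends the bound to \<open>V\<close>. If the sphere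
  is empty, \<open>V\<close> has no nonzero vector and any constant works.\<close>

lemma positive_definite_coercive:
  fixes A :: "real^'n^'n"
  assumes V: "subspace V" and pos: "\<And>v. v \<in> V - {0} \<Longrightarrow> 0 < v \<bullet> (A *v v)"
  obtains c where "0 < c" "\<And>v. v \<in> V \<Longrightarrow> c * (norm v)\<^sup>2 \<le> v \<bullet> (A *v v)"
proof (cases "V \<inter> sphere 0 1 = {}")
  case True
  then have "V - {0} = {}"
    using subspace_normalize[OF V] by blast
  then have "1 * (norm v)\<^sup>2 \<le> v \<bullet> (A *v v)" if "v \<in> V" for v
    using that by auto
  then show ?thesis
    using that[of 1] by simp
next
  case False
  obtain w where w: "w \<in> V \<inter> sphere 0 1"
    and min: "\<And>v. v \<in> V \<inter> sphere 0 1 \<Longrightarrow> w \<bullet> (A *v w) \<le> v \<bullet> (A *v v)"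
    using continuous_attains_inf[OF compact_subspace_sphere[OF V] False
        continuous_on_quadratic_form[of _ A]] by blast
  have "(w \<bullet> (A *v w)) * (norm v)\<^sup>2 \<le> v \<bullet> (A *v v)" if "v \<in> V" for v
  proof (cases "v = 0")
    case False
    with min[OF subspace_normalize[OF V, of v]] that
    have "w \<bullet> (A *v w) \<le> (v \<bullet> (A *v v)) / (norm v)\<^sup>2"
      by (simp only: quadratic_form_scaleR) (simp add: field_simps)
    with False show ?thesis
      by (simp add: field_simps)
  qed simp
  moreover have "0 < w \<bullet> (A *v w)"
    using w by (intro pos) auto
  ultimately show ?thesis
    using that by blast
qed

text \<open>The quotient is invariant under scaling, so its supremum is a maximum over a compact
  sphere. Attainment is what lets a pointwise strict bound by 1 survive the supremum.\<close>

lemma quadratic_form_quotient_attained: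
  fixes A B :: "real^'n^'n"
  assumes V: "subspace V" and nontriv: "V \<noteq> {0}"
    and dom: "\<And>v. v \<in> V - {0} \<Longrightarrow> \<bar>v \<bullet> (B *v v)\<bar> < v \<bullet> (A *v v)"
  obtains w where "w \<in> V - {0}"
    "\<And>v. v \<in> V - {0} \<Longrightarrow>
      \<bar>v \<bullet> (B *v v)\<bar> / (v \<bullet> (A *v v)) \<le> \<bar>w \<bullet> (B *v w)\<bar> / (w \<bullet> (A *v w))"
proof -
  let ?f = "\<lambda>v. \<bar>v \<bullet> (B *v v)\<bar> / (v \<bullet> (A *v v))"
  let ?S = "V \<inter> sphere 0 1"
  have S: "?S \<noteq> {}"
    using nontriv subspace_0[OF V] subspace_normalize[OF V] by blast
  have "v \<bullet> (A *v v) \<noteq> 0" if "v \<in> ?S" for v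
    using dom[of v] that by force
  then have "continuous_on ?S ?f"
    by (intro continuous_on_divide continuous_on_rabs continuous_on_quadratic_form) auto
  then obtain w where w: "w \<in> ?S" and max: "\<And>v. v \<in> ?S \<Longrightarrow> ?f v \<le> ?f w"
    using continuous_attains_sup[OF compact_subspace_sphere[OF V] S] by blast
  have "?f v \<le> ?f w" if "v \<in> V - {0}" for v
  proof -
    have "?f v = ?f (v /\<^sub>R norm v)"
      using that by (simp only: quadratic_form_scaleR abs_mult) simp
    also have "\<dots> \<le> ?f w"
      using subspace_normalize[OF V that] by (rule max)
    finally show ?thesis .
  qed
  moreover have "w \<in> V - {0}"
    using w by auto
  ultimately show ?thesis
    using that by blast
qed

lemma symmetric_form_commute:
  fixes B :: "real^'n^'n"
  assumes "transpose B = B"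
  shows "u \<bullet> (B *v v) = v \<bullet> (B *v u)"
  by (metis assms dot_lmul_matrix inner_commute transpose_matrix_vector)

text \<open>A Cauchy--Schwarz inequality for \<open>B\<close> with respect to \<open>A\<close>. Polarization only involves
  \<open>A\<close> through its quadratic form, so \<open>A\<close> may be nonsymmetric.\<close>

lemma symmetric_form_le_sqrt:
  fixes A B :: "real^'n^'n"
  assumes V: "subspace V" and sym: "transpose B = B"
    and pos: "\<And>v. v \<in> V - {0} \<Longrightarrow> 0 < v \<bullet> (A *v v)"
    and bound: "\<And>v. v \<in> V \<Longrightarrow> \<bar>v \<bullet> (B *v v)\<bar> \<le> r * (v \<bullet> (A *v v))"
    and u: "u \<in> V" and v: "v \<in> V"
  shows "u \<bullet> (B *v v) \<le> r * (sqrt (u \<bullet> (A *v u)) * sqrt (v \<bullet> (A *v v)))"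
proof (cases "u = 0 \<or> v = 0")
  case True
  then show ?thesis by auto
next
  case False
  define p q where "p = sqrt (u \<bullet> (A *v u))" and "q = sqrt (v \<bullet> (A *v v))"
  have pq: "0 < p" "0 < q" "u \<bullet> (A *v u) = p\<^sup>2" "v \<bullet> (A *v v) = q\<^sup>2"
    using pos[of u] pos[of v] u v False by (auto simp: p_def q_def)
  \<comment> \<open>This rescaling gives both vectors the same form value, so that the sum of the
    two values below equals twice their geometric mean.\<close>
  define x y where "x = q *\<^sub>R u" and "y = p *\<^sub>R v"
  have xy: "x + y \<in> V" "x - y \<in> V"
    using V u v by (auto simp: x_def y_def intro: subspace_add subspace_diff subspace_scale)
  have quad: "x \<bullet> (A *v x) = p\<^sup>2 * q\<^sup>2" "y \<bullet> (A *v y) = p\<^sup>2 * q\<^sup>2"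
    by (simp_all only: x_def y_def quadratic_form_scaleR pq(3,4)) (simp add: mult.commute)
  have cross: "x \<bullet> (B *v y) = p * q * (u \<bullet> (B *v v))"
    by (simp add: x_def y_def matrix_vector_mult_scaleR)
  \<comment> \<open>Polarization: symmetry of \<open>B\<close> merges the two mixed terms.\<close>
  have "4 * (x \<bullet> (B *v y)) = (x + y) \<bullet> (B *v (x + y)) - (x - y) \<bullet> (B *v (x - y))"
    using symmetric_form_commute[OF sym, of x y]
    by (simp add: matrix_vector_right_distrib matrix_vector_mult_diff_distrib inner_add_left
        inner_add_right inner_diff_left inner_diff_right)
  also have "\<dots> \<le> r * ((x + y) \<bullet> (A *v (x + y))) + r * ((x - y) \<bullet> (A *v (x - y)))"
    using bound[OF xy(1)] bound[OF xy(2)] by linarith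
  \<comment> \<open>Parallelogram identity: the mixed terms of \<open>A\<close> cancel in the
    sum.\<close>
  also have "\<dots> = 2 * r * (x \<bullet> (A *v x) + y \<bullet> (A *v y))"
    by (simp add: matrix_vector_right_distrib matrix_vector_mult_diff_distrib inner_add_left
        inner_add_right inner_diff_left inner_diff_right algebra_simps)
  finally have "(p * q) * (u \<bullet> (B *v v)) \<le> (p * q) * (r * (p * q))"
    by (simp add: quad cross power2_eq_square algebra_simps)
  then have "u \<bullet> (B *v v) \<le> r * (p * q)"
    using pq by (meson mult_le_cancel_left_pos mult_pos_pos)
  then show ?thesis
    by (simp add: p_def q_def)
qed

subsection \<open>The rate and the partial derivatives\<close>

lemma subspace_dir_space: "subspace (dir_space S)"
  by (simp add: dir_space_def)

lemma diff_in_dir_space: "x \<in> S \<Longrightarrow> y \<in> S \<Longrightarrow> x - y \<in> dir_space S"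
  unfolding dir_space_def by (rule span_base) blast

lemma rho_hat_real:
  assumes dom: "\<forall>v \<in> dir_space S - {0}. \<bar>v \<bullet> (B_mat Q t *v v)\<bar> < v \<bullet> (A_mat Q t *v v)"
  obtains r where "rho_hat Q S t = ereal r" "0 \<le> r" "r < 1"
    "\<And>v. v \<in> dir_space S \<Longrightarrow> \<bar>v \<bullet> (B_mat Q t *v v)\<bar> \<le> r * (v \<bullet> (A_mat Q t *v v))"
proof (cases "dir_space S = {0}")
  case True
  then show ?thesis
    using that[of 0] by (simp add: rho_hat_def zero_ereal_def)
next
  case False
  let ?f = "\<lambda>v. \<bar>v \<bullet> (B_mat Q t *v v)\<bar> / (v \<bullet> (A_mat Q t *v v))"
  obtain w where w: "w \<in> dir_space S - {0}" and max: "\<And>v. v \<in> dir_space S - {0} \<Longrightarrow> ?f v \<le> ?f w"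
    using quadratic_form_quotient_attained[OF subspace_dir_space False, of "B_mat Q t" "A_mat Q t"]
      dom by blast
  have "(SUP v \<in> dir_space S - {0}. ereal (?f v)) = ereal (?f w)"
    using w max by (intro antisym SUP_least SUP_upper) auto
  then have "rho_hat Q S t = ereal (?f w)"
    using False by (simp add: rho_hat_def)
  moreover have "\<bar>w \<bullet> (B_mat Q t *v w)\<bar> < w \<bullet> (A_mat Q t *v w)"
    using dom w by blast
  then have "0 \<le> ?f w" "?f w < 1"
    by (auto simp: divide_less_eq)
  moreover have "\<bar>v \<bullet> (B_mat Q t *v v)\<bar> \<le> ?f w * (v \<bullet> (A_mat Q t *v v))"
    if "v \<in> dir_space S" for v
  proof (cases "v = 0")
    case False
    then have "0 < v \<bullet> (A_mat Q t *v v)"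
      using dom that by force
    then show ?thesis
      using max[of v] that False by (simp add: pos_divide_le_eq)
  qed simp
  ultimately show ?thesis
    using that by blast
qed

text \<open>Restricting the joint derivative to the two coordinate axes yields the partial
  derivatives, which uniqueness identifies with the Jacobians; additivity recombines them. The minus
  sign comes from \<open>B_mat\<close>.\<close>

lemma grad2_has_derivative:
  assumes "(\<lambda>(x, y). grad2 Q x y) differentiable (at (t, t))"
  shows "((\<lambda>(x, y). grad2 Q x y) has_derivative (\<lambda>(h, k). A_mat Q t *v k - B_mat Q t *v h))
    (at (t, t))"
proof -
  obtain D where D: "((\<lambda>(x, y). grad2 Q x y) has_derivative D) (at (t, t))"
    using assms by (auto simp: differentiable_def)
  interpret D: bounded_linear D
    using D by (rule has_derivative_bounded_linear)
  have 1: "((\<lambda>x. grad2 Q x t) has_derivative (\<lambda>h. D (h, 0))) (at t)"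
    using has_derivative_compose[OF has_derivative_Pair[OF has_derivative_ident has_derivative_const] D]
    by simp
  then have "((\<lambda>x. grad2 Q x t) has_derivative (\<lambda>h. - B_mat Q t *v h)) (at t)"
    by (simp add: B_mat_def flip: jacobian_works) (auto simp: differentiable_def)
  \<comment> \<open>The derivative above applies the negated matrix; the distributivity instance at
    0 moves the sign outside the product.\<close>
  from has_derivative_unique[OF 1 this] have B: "D (h, 0) = - (B_mat Q t *v h)" for h
    using matrix_vector_mult_diff_rdistrib[of 0 "B_mat Q t" h] by (auto dest: fun_cong[of _ _ h])
  have 2: "((\<lambda>y. grad2 Q t y) has_derivative (\<lambda>k. D (0, k))) (at t)"
    using has_derivative_compose[OF has_derivative_Pair[OF has_derivative_const has_derivative_ident] D]
    by simp
  then have "((\<lambda>y. grad2 Q t y) has_derivative (\<lambda>k. A_mat Q t *v k)) (at t)"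
    by (simp add: A_mat_def flip: jacobian_works) (auto simp: differentiable_def)
  from has_derivative_unique[OF 2 this] have A: "D (0, k) = A_mat Q t *v k" for k
    by metis
  have "D (h, k) = A_mat Q t *v k - B_mat Q t *v h" for h k
    using D.add[of "(0, k)" "(h, 0)"] by (simp add: A B)
  then have "D = (\<lambda>(h, k). A_mat Q t *v k - B_mat Q t *v h)"
    by auto
  with D show ?thesis
    by simp
qed

section \<open>First-order optimality on a convex set\<close>

lemma GDERIV_unique:
  assumes "GDERIV f x :> D" "GDERIV f x :> E"
  shows "D = E"
proof -
  have "(\<lambda>h. h \<bullet> D) = (\<lambda>h. h \<bullet> E)"
    using assms unfolding gderiv_def by (rule has_derivative_unique)
  then have "h \<bullet> D = h \<bullet> E" for h
    by meson
  then have "(D - E) \<bullet> (D - E) = 0"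
    by (simp add: inner_diff_right)
  then show ?thesis
    by simp
qed

lemma GDERIV_grad2: "has_grad2_at Q x y \<Longrightarrow> GDERIV (Q x) y :> grad2 Q x y"
  unfolding has_grad2_at_def grad2_def by (metis GDERIV_unique theI')

text \<open>A negative slope from \<open>x\<close> towards \<open>y\<close> would make
  \<open>f\<close> drop below its minimum at a nearby point of the segment, which lies in
  \<open>S\<close>.\<close>

lemma GDERIV_convex_argmin:
  assumes D: "GDERIV f x :> D" and "convex S" and min: "x \<in> argmin_on f S" and y: "y \<in> S"
  shows "0 \<le> (y - x) \<bullet> D"
proof (rule ccontr)
  assume neg: "\<not> 0 \<le> (y - x) \<bullet> D"
  have x: "x \<in> S" and le: "\<And>z. z \<in> S \<Longrightarrow> f x \<le> f z"
    using min by (auto simp: argmin_on_def is_arg_min_linorder)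
  let ?g = "\<lambda>t::real. f (x + t *\<^sub>R (y - x))"
  \<comment> \<open>The base point is written as the value of the segment path at 0, to fit the
    chain rule.\<close>
  have "(f has_derivative (\<lambda>h. h \<bullet> D)) (at (x + 0 *\<^sub>R (y - x)))"
    using D by (simp add: gderiv_def)
  then have "(?g has_derivative (\<lambda>t. (t *\<^sub>R (y - x)) \<bullet> D)) (at 0)"
    by (rule has_derivative_compose[of "\<lambda>t. x + t *\<^sub>R (y - x)" "\<lambda>t. t *\<^sub>R (y - x)" 0 UNIV, rotated])
      (auto intro!: derivative_eq_intros)
  then have "DERIV ?g 0 :> (y - x) \<bullet> D"
    by (simp add: has_field_derivative_def mult.commute[of _ "(y - x) \<bullet> D"])
  then obtain d where d: "d > 0" "\<And>h. 0 < h \<Longrightarrow> h < d \<Longrightarrow> ?g h < ?g 0"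
    using DERIV_neg_dec_right[of ?g _ 0] neg unfolding add_0 by (meson not_le)
  \<comment> \<open>Below \<open>d\<close> to force a strict decrease, at most 1 to stay on the
    segment.\<close>
  let ?h = "min (d / 2) 1"
  have "?h < d"
    using d(1) by (simp add: min_def)
  have "x + ?h *\<^sub>R (y - x) = (1 - ?h) *\<^sub>R x + ?h *\<^sub>R y"
    by (simp add: algebra_simps)
  also have "\<dots> \<in> S"
    using \<open>convex S\<close> x y d(1) by (intro convexD) auto
  finally have "f x \<le> ?g ?h"
    by (rule le)
  with d(2)[of ?h] d(1) \<open>?h < d\<close> show False
    by auto
qed

subsection \<open>Convergence rates\<close>

text \<open>Iterating the contraction from the index \<open>m\<close> where it sets in gives
  geometric decay; the divisor \<open>s ^ m\<close> compensates for the shifted start.\<close>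

lemma eventually_contracting_bigo:
  fixes a :: "nat \<Rightarrow> real"
  assumes nonneg: "\<And>n. 0 \<le> a n" and s: "0 < s"
    and contr: "\<forall>\<^sub>F n in sequentially. a (Suc n) \<le> s * a n"
  shows "a \<in> O(\<lambda>n. s ^ n)"
proof -
  obtain m where m: "\<And>n. n \<ge> m \<Longrightarrow> a (Suc n) \<le> s * a n"
    using contr by (auto simp: eventually_sequentially)
  have "a n \<le> a m / s ^ m * s ^ n" if "n \<ge> m" for n
    using that
  proof (induction n rule: dec_induct)
    case base
    with s show ?case by simp
  next
    case (step n)
    from m[OF step(1)] mult_left_mono[OF step(3), of s] s show ?case
      by (simp add: algebra_simps)
  qed
  then have "\<forall>\<^sub>F n in sequentially. norm (a n) \<le> a m / s ^ m * norm (s ^ n)"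
    using nonneg s by (auto simp: eventually_sequentially)
  then show ?thesis
    by (rule bigoI)
qed

lemma power_smallo_power:
  fixes s \<rho> :: real
  assumes "0 < s" "s < \<rho>"
  shows "(\<lambda>n. s ^ n) \<in> o(\<lambda>n. \<rho> ^ n)"
proof (rule smalloI_tendsto)
  have "(\<lambda>n. (s / \<rho>) ^ n) \<longlonglongrightarrow> 0"
    using assms by (intro LIMSEQ_power_zero) simp
  then show "(\<lambda>n. s ^ n / \<rho> ^ n) \<longlonglongrightarrow> 0"
    by (simp add: power_divide)
qed (use assms in simp)

lemma limsup_log_le_of_smallo_power:
  fixes a :: "nat \<Rightarrow> real"
  assumes nonneg: "\<And>n. 0 \<le> a n" and \<rho>: "0 < \<rho>" and small: "a \<in> o(\<lambda>n. \<rho> ^ n)"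
  shows "limsup (\<lambda>n. ereal (1 / real n) * elog (ereal (a n))) \<le> ereal (ln \<rho>)"
proof (rule Limsup_bounded)
  have "\<forall>\<^sub>F n in sequentially. norm (a n) \<le> 1 * norm (\<rho> ^ n)"
    using small zero_less_one by (rule landau_o.smallD)
  then show "\<forall>\<^sub>F n in sequentially. ereal (1 / real n) * elog (ereal (a n)) \<le> ereal (ln \<rho>)"
    \<comment> \<open>At index 0 the factor \<open>1 / real n\<close> is 0 and would annihilate the
      logarithm.\<close>
    using eventually_gt_at_top[of 0]
  proof eventually_elim
    case (elim n)
    show ?case
    proof (cases "a n = 0")
      case True
      with elim show ?thesis
        by (simp add: elog_def)
    next
      case False
      with nonneg[of n] have pos: "0 < a n"
        by simp
      then have "ln (a n) \<le> ln (\<rho> ^ n)"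
        using elim \<rho> by simp
      also have "\<dots> = real n * ln \<rho>"
        using \<rho> by (simp add: ln_realpow)
      finally show ?thesis
        using pos elim by (simp add: elog_def field_simps)
    qed
  qed
qed

text \<open>Lets \<rho> decrease to \<open>r\<close>. A real \<open>z\<close> strictly between the
  two sides treats \<open>r = 0\<close>, where the right side is minus infinity, together with
  \<open>r > 0\<close>.\<close>

lemma le_elog_if_le_ln:
  assumes r: "0 \<le> r" "r < 1" and le: "\<And>\<rho>. r < \<rho> \<Longrightarrow> \<rho> < 1 \<Longrightarrow> L \<le> ereal (ln \<rho>)"
  shows "L \<le> elog (ereal r)"
proof (rule ccontr)
  assume "\<not> L \<le> elog (ereal r)"
  then obtain z where z: "elog (ereal r) < ereal z" "ereal z < L"
    by (meson ereal_dense2 not_le)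
  have "r < exp z"
  proof (cases "r = 0")
    case False
    with z(1) r have "ln r < z"
      by (simp add: elog_def)
    with False r show ?thesis
      by (metis exp_less_mono exp_ln less_eq_real_def)
  qed simp
  then obtain \<rho> where \<rho>: "r < \<rho>" "\<rho> < min 1 (exp z)"
    using dense[of r "min 1 (exp z)"] r by auto
  then have "ln \<rho> < z"
    using r by (metis exp_ln exp_less_cancel_iff less_le_trans le_less_trans min.strict_boundedE)
  with le[of \<rho>] \<rho> z(2) show False
    by (metis ereal_less_eq(3) less_le_not_le min_less_iff_conj order_trans)
qed

section \<open>Contraction of the errors in the norm induced by the quadratic form of
  \<open>A\<close>\<close>

theorem theorem1:
  fixes Q :: "real^'q \<Rightarrow> real^'q \<Rightarrow> real"
    and \<Theta> :: "(real^'q) set"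
    and \<theta> :: "nat \<Rightarrow> real^'q"
    and \<theta>s :: "real^'q"
  assumes argmin_nonempty: "\<And>t. t \<in> \<Theta> \<Longrightarrow> argmin_on (Q t) \<Theta> \<noteq> {}"
    and seq_in: "\<And>n. \<theta> n \<in> \<Theta>"
    and seq_step: "\<And>n. \<theta> (Suc n) \<in> argmin_on (Q (\<theta> n)) \<Theta>"
    and star_in: "\<theta>s \<in> \<Theta>"
    and grad_near: "\<forall>\<^sub>F (x, y) in nhds (\<theta>s, \<theta>s). has_grad2_at Q x y"
    and grad_diff: "(\<lambda>(x, y). grad2 Q x y) differentiable (at (\<theta>s, \<theta>s))"
    and convex: "convex \<Theta>"
    and conv: "\<theta> \<longlonglongrightarrow> \<theta>s"
    and regular: "\<exists>U. open U \<and> (\<theta>s, \<theta>s) \<in> U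
        \<and> continuous_on U (\<lambda>(x, y). Q x y)
        \<and> (\<forall>(x, y)\<in>U. has_grad2_at Q x y)
        \<and> C1_on (\<lambda>(x, y). grad2 Q x y) U"
    and B_sym: "transpose (B_mat Q \<theta>s) = B_mat Q \<theta>s"
    and A_dom: "\<forall>v \<in> dir_space \<Theta> - {0}.
        v \<bullet> (A_mat Q \<theta>s *v v) > \<bar>v \<bullet> (B_mat Q \<theta>s *v v)\<bar>"
  shows "0 \<le> rho_hat Q \<Theta> \<theta>s \<and> rho_hat Q \<Theta> \<theta>s < 1
    \<and> (\<forall>\<rho>::real. rho_hat Q \<Theta> \<theta>s < ereal \<rho> \<and> \<rho> < 1 \<longrightarrow>
         (\<lambda>n. norm (\<theta> n - \<theta>s)) \<in> o(\<lambda>n. \<rho> ^ n))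
    \<and> limsup (\<lambda>n. ereal (1 / real n) * elog (ereal (norm (\<theta> n - \<theta>s))))
        \<le> elog (rho_hat Q \<Theta> \<theta>s)"
proof -
  define V where "V = dir_space \<Theta>"
  define A where "A = A_mat Q \<theta>s"
  define B where "B = B_mat Q \<theta>s"
  define e where "e n = \<theta> n - \<theta>s" for n
  define N where "N v = sqrt (v \<bullet> (A *v v))" for v
  define g where "g n = grad2 Q (\<theta> n) (\<theta> (Suc n))" for n
  define gs where "gs = grad2 Q \<theta>s \<theta>s"
  have V: "subspace V" and eV: "e n \<in> V" for n
    using seq_in star_in by (simp_all add: V_def e_def subspace_dir_space diff_in_dir_space)
  have Apos: "0 < v \<bullet> (A *v v)" if "v \<in> V - {0}" for v
    using A_dom that by (force simp: V_def A_def)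
  obtain c where c: "0 < c" "\<And>v. v \<in> V \<Longrightarrow> c * (norm v)\<^sup>2 \<le> v \<bullet> (A *v v)"
    using positive_definite_coercive[OF V Apos] by blast
  \<comment> \<open>On \<open>V\<close> coercivity makes the form nonnegative, so the square root in
    \<open>N\<close> can be undone.\<close>
  have N2: "v \<bullet> (A *v v) = (N v)\<^sup>2" and N0: "0 \<le> N v" if "v \<in> V" for v
    using order_trans[OF _ c(2)[OF that]] c(1) by (simp_all add: N_def)
  define K where "K = 1 / sqrt c"
  have K: "0 < K"
    using c(1) by (simp add: K_def)
  have normN: "norm v \<le> K * N v" if "v \<in> V" for v
  proof -
    have "sqrt c * norm v \<le> N v"
      using real_sqrt_le_mono[OF c(2)[OF that]] by (simp add: N_def real_sqrt_mult)
    then show ?thesis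
      using c(1) by (simp add: K_def field_simps)
  qed
  obtain r where rho: "rho_hat Q \<Theta> \<theta>s = ereal r" and r: "0 \<le> r" "r < 1"
    and quot: "\<And>v. v \<in> V \<Longrightarrow> \<bar>v \<bullet> (B *v v)\<bar> \<le> r * (v \<bullet> (A *v v))"
    using rho_hat_real[OF A_dom] unfolding V_def A_def B_def by blast
  have CS: "u \<bullet> (B *v v) \<le> r * (N u * N v)" if "u \<in> V" "v \<in> V" for u v
    unfolding N_def using symmetric_form_le_sqrt[OF V _ Apos quot that] B_sym by (simp add: B_def)

  have deriv: "((\<lambda>(x, y). grad2 Q x y) has_derivative (\<lambda>(h, k). A *v k - B *v h)) (at (\<theta>s, \<theta>s))"
    unfolding A_def B_def by (rule grad2_has_derivative[OF grad_diff])
  have conv2: "(\<lambda>n. (\<theta> n, \<theta> (Suc n))) \<longlonglongrightarrow> (\<theta>s, \<theta>s)"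
    by (intro tendsto_Pair conv LIMSEQ_Suc)
  have g_lim: "g \<longlonglongrightarrow> gs"
    using isCont_tendsto_compose[OF has_derivative_continuous[OF deriv] conv2]
    by (simp add: g_def[abs_def] gs_def)
  have ev_grad: "\<forall>\<^sub>F n in sequentially. has_grad2_at Q (\<theta> n) (\<theta> (Suc n))"
    using eventually_compose_filterlim[OF grad_near conv2] by simp
  have opt: "\<forall>\<^sub>F n in sequentially. \<forall>y\<in>\<Theta>. 0 \<le> (y - \<theta> (Suc n)) \<bullet> g n"
    using ev_grad
    by eventually_elim (use GDERIV_convex_argmin[OF _ convex seq_step] GDERIV_grad2 in
      \<open>unfold g_def, blast\<close>)
  \<comment> \<open>Obtained as the limit of the inequalities for the iterates, not from minimality
    of \<open>\<theta>s\<close>.\<close>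
  have opt_star: "0 \<le> (y - \<theta>s) \<bullet> gs" if "y \<in> \<Theta>" for y
  proof (rule tendsto_lowerbound)
    show "(\<lambda>n. (y - \<theta> (Suc n)) \<bullet> g n) \<longlonglongrightarrow> (y - \<theta>s) \<bullet> gs"
      by (intro tendsto_intros g_lim LIMSEQ_Suc conv)
    show "\<forall>\<^sub>F n in sequentially. 0 \<le> (y - \<theta> (Suc n)) \<bullet> g n"
      using opt by eventually_elim (use that in blast)
  qed simp
  \<comment> \<open>Adds \<open>opt\<close> tested at \<open>\<theta>s\<close> to
    \<open>opt_star\<close> tested at the next iterate.\<close>
  have opt_diff: "\<forall>\<^sub>F n in sequentially. e (Suc n) \<bullet> (g n - gs) \<le> 0"
    using opt
  proof eventually_elim
    case (elim n)
    from bspec[OF elim star_in] opt_star[OF seq_in, of "Suc n"] show ?case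
      by (simp add: e_def inner_diff_left inner_diff_right)
  qed
  have remainder: "\<forall>\<^sub>F n in sequentially.
      norm (g n - gs - (A *v e (Suc n) - B *v e n)) \<le> \<epsilon> * (norm (e n) + norm (e (Suc n)))"
    if \<epsilon>: "0 < \<epsilon>" for \<epsilon>
  proof -
    obtain d where d: "d > 0" and rem: "\<And>p. norm (p - (\<theta>s, \<theta>s)) < d \<Longrightarrow>
        norm ((\<lambda>(x, y). grad2 Q x y) p - gs - (\<lambda>(h, k). A *v k - B *v h) (p - (\<theta>s, \<theta>s)))
          \<le> \<epsilon> * norm (p - (\<theta>s, \<theta>s))"
      using deriv \<epsilon> unfolding has_derivative_at_alt gs_def by auto
    have "\<forall>\<^sub>F n in sequentially. norm ((\<theta> n, \<theta> (Suc n)) - (\<theta>s, \<theta>s)) < d"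
      using tendstoD[OF conv2 d] by (simp add: dist_norm)
    then show ?thesis
    proof eventually_elim
      case (elim n)
      have "norm (g n - gs - (A *v e (Suc n) - B *v e n)) \<le> \<epsilon> * norm (e n, e (Suc n))"
        using rem[OF elim] by (simp add: e_def g_def)
      also have "\<dots> \<le> \<epsilon> * (norm (e n) + norm (e (Suc n)))"
        using \<epsilon> by (intro mult_left_mono norm_Pair_le) simp
      finally show ?case .
    qed
  qed
  have contr: "\<forall>\<^sub>F n in sequentially. N (e (Suc n)) \<le> s * N (e n)" if s: "r < s" for s
  proof -
    \<comment> \<open>solves \<open>(r + \<delta>) / (1 - \<delta>) = s\<close>\<close>
    define \<delta> where "\<delta> = (s - r) / (1 + s)"
    have \<delta>: "0 < \<delta>" "\<delta> < 1" and \<delta>_eq: "r + \<delta> = s * (1 - \<delta>)"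
      using s r by (auto simp: \<delta>_def field_simps)
    \<comment> \<open>Two Euclidean norms will be replaced by \<open>N\<close>, each at the cost of
      a factor \<open>K\<close>; dividing by \<open>K\<^sup>2\<close> leaves exactly
      \<delta>.\<close>
    from \<delta>(1) K have "0 < \<delta> / K\<^sup>2"
      by simp
    from remainder[OF this] opt_diff show ?thesis
    proof eventually_elim
      case (elim n)
      let ?x = "e n" and ?y = "e (Suc n)"
      let ?R = "g n - gs - (A *v ?y - B *v ?x)"
      note x = eV[of n] and y = eV[of "Suc n"]
      \<comment> \<open>An exact identity from the definition of \<open>?R\<close>; its first term
        is at most 0 by \<open>opt_diff\<close>.\<close>
      have "(N ?y)\<^sup>2 = ?y \<bullet> (g n - gs) + ?y \<bullet> (B *v ?x) - ?y \<bullet> ?R"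
        by (simp add: N2[OF y, symmetric] inner_diff_right)
      also have "\<dots> \<le> r * (N ?y * N ?x) + norm ?y * norm ?R"
        using elim(2) CS[OF y x] Cauchy_Schwarz_ineq2[of ?y ?R] by linarith
      also have "norm ?y * norm ?R \<le> (K * N ?y) * (\<delta> / K\<^sup>2 * (K * N ?x + K * N ?y))"
        using K \<delta> N0[OF x] N0[OF y]
        by (intro mult_mono normN[OF y] order_trans[OF elim(1)] mult_left_mono add_mono normN x y) auto
      also have "\<dots> = \<delta> * N ?y * (N ?x + N ?y)"
        using K by (simp add: field_simps power2_eq_square)
      finally have "N ?y * ((1 - \<delta>) * N ?y) \<le> N ?y * ((r + \<delta>) * N ?x)"
        by (simp add: algebra_simps power2_eq_square)
      moreover have "(r + \<delta>) * N ?x = (1 - \<delta>) * (s * N ?x)"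
        by (simp add: \<delta>_eq)
      ultimately have "N ?y * ((1 - \<delta>) * N ?y) \<le> N ?y * ((1 - \<delta>) * (s * N ?x))"
        by simp
      \<comment> \<open>Cancels \<open>N ?y\<close> and \<open>1 - \<delta>\<close>; if
        \<open>N ?y = 0\<close> the claim holds because its right side is nonnegative.\<close>
      then show ?case
        using \<delta>(2) N0[OF x] N0[OF y] s r by (cases "N ?y = 0") (auto simp: mult_le_cancel_left)
    qed
  qed
  have small: "(\<lambda>n. norm (e n)) \<in> o(\<lambda>n. \<rho> ^ n)" if \<rho>: "r < \<rho>" for \<rho>
  proof -
    \<comment> \<open>The room between \<open>s\<close> and \<rho> upgrades big-O to little-o, and
      \<open>s\<close> is positive even if \<open>r = 0\<close>.\<close>
    obtain s where s: "r < s" "s < \<rho>"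
      using dense[OF \<rho>] by blast
    have "(\<lambda>n. norm (e n)) \<in> O(\<lambda>n. N (e n))"
      using normN[OF eV] N0[OF eV] by (intro bigoI[of _ K]) simp
    also have "(\<lambda>n. N (e n)) \<in> O(\<lambda>n. s ^ n)"
      using s r by (intro eventually_contracting_bigo contr N0 eV) auto
    also have "(\<lambda>n. s ^ n) \<in> o(\<lambda>n. \<rho> ^ n)"
      using s r by (intro power_smallo_power) auto
    finally show ?thesis .
  qed
  have "limsup (\<lambda>n. ereal (1 / real n) * elog (ereal (norm (e n)))) \<le> elog (ereal r)"
    using r by (intro le_elog_if_le_ln limsup_log_le_of_smallo_power small) auto
  with r small show ?thesis
    by (auto simp: rho e_def)
qed

end
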